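(* Let $p\ge 1$, $n=2^p$, and for $i\in\{1,\dots,n\}$ let $g_i\in\mathbb{Z}_2^p$ be the binary representation (a $0$/$1$ row vector of length $p$) of the integer $i-1$. Let $H=[h_{i,j}]$ be the $n\times n$ Sylvester Hadamard matrix, $h_{i,j}=(-1)^{\langle g_i,g_j\rangle}$. For an $r\times p$ $(0,1)$-matrix $M$ with pairwise distinct rows, let $\alpha_M=\{i\in\{1,\dots,n\}: g_i \text{ is a row of } M\}$ and define $$\Phi(\alpha_M)=\prod_{j=2}^{n}\sum_{i\in\alpha_M}h_{i,j}.$$ Then for every such $M$ (in particular for every SIOR $r\times p$ matrix $M$): (1) $\Phi(\alpha_M)$ is invariant under permutations of the rows of $M$; (2) $\Phi(\alpha_M)$ is invariant under permutations of the columns of $M$; (3) $\Phi(\alpha_M)$ is invariant under complementation of any column of $M$.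
   Context: An $r\times p$ $(0,1)$-matrix is SIOR if, reading each row as a binary number, its $i$-th row is strictly less than its $j$-th row whenever $i<j$. Complementation of a column means changing every entry of that column from $0$ to $1$ and from $1$ to $0$. $\langle\cdot,\cdot\rangle$ is the standard inner product of vectors with integer entries $0,1$.
   Formalization: Part (3) is proved except when p = r = 1, where it is false: M = [0] gives Φ = 1 while its complement [1] gives Φ = −1; parts (1) and (2) are proved for all p ≥ 1 and all r. *)

theory Defs
  imports "Jordan_Normal_Form.Matrix" "HOL-Combinatorics.Permutations"
begin

text \<open>Rows and columns of type \<open>mat\<close> are indexed from 0; the index sets \<open>{1..2 ^ p}\<close> below
  are 1-based, so \<open>h\<^sub>i\<^sub>,\<^sub>j\<close> is the entry at position \<open>(i - 1, j - 1)\<close>.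
  Binary representations have the most significant digit first.\<close>

definition binary_vec :: "nat \<Rightarrow> nat \<Rightarrow> int vec" where
  "binary_vec p m = vec p (\<lambda>k. int (m div 2 ^ (p - 1 - k) mod 2))"

definition binary_value :: "int vec \<Rightarrow> int" where
  "binary_value v = (\<Sum>k<dim_vec v. v $ k * 2 ^ (dim_vec v - 1 - k))"

definition g :: "nat \<Rightarrow> nat \<Rightarrow> int vec" where
  "g p i = binary_vec p (i - 1)"

definition zero_one_mat :: "nat \<Rightarrow> nat \<Rightarrow> int mat \<Rightarrow> bool" where
  "zero_one_mat r p M \<longleftrightarrow> M \<in> carrier_mat r p \<and> elements_mat M \<subseteq> {0, 1}"

definition SIOR :: "nat \<Rightarrow> nat \<Rightarrow> int mat \<Rightarrow> bool" where
  "SIOR r p M \<longleftrightarrow> zero_one_mat r p M \<and>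
     (\<forall>j<r. \<forall>i<j. binary_value (row M i) < binary_value (row M j))"

definition sylvester_mat :: "nat \<Rightarrow> int mat" where
  "sylvester_mat p =
     mat (2 ^ p) (2 ^ p) (\<lambda>(i, j). (- 1) ^ nat (g p (i + 1) \<bullet> g p (j + 1)))"

definition alpha :: "nat \<Rightarrow> int mat \<Rightarrow> nat set" where
  "alpha p M = {i \<in> {1..2 ^ p}. g p i \<in> set (rows M)}"

definition Phi :: "nat \<Rightarrow> nat set \<Rightarrow> int" where
  "Phi p A = (\<Prod>j = 2..2 ^ p. \<Sum>i\<in>A. sylvester_mat p $$ (i - 1, j - 1))"

definition permute_rows :: "(nat \<Rightarrow> nat) \<Rightarrow> 'a mat \<Rightarrow> 'a mat" where
  "permute_rows \<pi> M = mat (dim_row M) (dim_col M) (\<lambda>(i, k). M $$ (\<pi> i, k))"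

definition permute_cols :: "(nat \<Rightarrow> nat) \<Rightarrow> 'a mat \<Rightarrow> 'a mat" where
  "permute_cols \<sigma> M = mat (dim_row M) (dim_col M) (\<lambda>(i, k). M $$ (i, \<sigma> k))"

definition complement_col :: "nat \<Rightarrow> int mat \<Rightarrow> int mat" where
  "complement_col c M =
     mat (dim_row M) (dim_col M) (\<lambda>(i, k). if k = c then 1 - M $$ (i, k) else M $$ (i, k))"

text \<open>Complementing column \<open>c\<close> multiplies the factor for \<open>j\<close> by \<open>-1\<close> for each of the \<open>2 ^ (p - 1)\<close>
  indices \<open>j\<close> whose binary vector has a 1 at position \<open>c\<close>. This count is odd exactly for \<open>p = 1\<close>,
  and there \<open>\<Phi>\<close> vanishes unless \<open>r = 1\<close>. So invariance under complementation fails in exactly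
  one case, \<open>p = r = 1\<close>:\<close>

lemma complement_col_not_invariant_1_1:
  assumes "M = mat 1 1 (\<lambda>_. 0)"
  shows "zero_one_mat 1 1 M" "distinct (rows M)"
    "Phi 1 (alpha 1 M) = 1" "Phi 1 (alpha 1 (complement_col 0 M)) = - 1"
proof -
  let ?N = "mat 1 1 (\<lambda>_. 1) :: int mat"
  have compl: "complement_col 0 M = ?N"
    by (rule eq_matI) (auto simp: complement_col_def assms)
  have rM: "rows M = [vec 1 (\<lambda>_. 0)]" and rN: "rows ?N = [vec 1 (\<lambda>_. 1)]"
    by (auto simp: rows_def row_def assms intro!: eq_vecI)
  have g1: "g 1 1 = vec 1 (\<lambda>_. 0)" and g2: "g 1 2 = vec 1 (\<lambda>_. 1)"
    by (auto simp: g_def binary_vec_def intro!: eq_vecI)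
  have ne: "vec 1 (\<lambda>_. 0 :: int) \<noteq> vec 1 (\<lambda>_. 1)"
    by (metis index_vec less_one zero_neq_one)
  have I: "{1..2 ^ 1} = {1, 2 :: nat}" by auto
  have aM: "alpha 1 M = {1}" and aN: "alpha 1 ?N = {2}"
    unfolding alpha_def I rM rN using g1 g2 ne ne[symmetric] by auto
  have h: "sylvester_mat 1 $$ (0, 1) = 1" "sylvester_mat 1 $$ (1, 1) = - 1"
    using g1 g2 by (auto simp: sylvester_mat_def scalar_prod_def numeral_2_eq_2)
  show "zero_one_mat 1 1 M" by (auto simp: zero_one_mat_def assms)
  show "distinct (rows M)" by (simp add: rM)
  show "Phi 1 (alpha 1 M) = 1" "Phi 1 (alpha 1 (complement_col 0 M)) = - 1"
    unfolding compl aM aN Phi_def using h by simp_all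
qed

end

theory Submission
  imports Defs
begin

text \<open>Since \<open>g\<close> enumerates the binary vectors of length \<open>p\<close>, starting with the zero vector,
  \<open>\<Phi>\<close> is the product over all non-zero binary \<open>w\<close> of \<open>\<Sum>v. (-1)\<^bsup>\<langle>v, w\<rangle>\<^esup>\<close>, where \<open>v\<close> runs
  over the set of rows. This only depends on that set of rows. A column permutation is undone by
  applying the same permutation to the coordinates of \<open>w\<close>. Complementing column \<open>c\<close> multiplies
  the factor of \<open>w\<close> by \<open>(-1)\<^bsup>w\<^sub>c\<^esup>\<close>; for \<open>p \<ge> 2\<close> these signs cancel in pairs, by flipping a
  coordinate \<open>d \<noteq> c\<close> of \<open>w\<close>, and for \<open>p = 1\<close>, \<open>r \<noteq> 1\<close> the set of rows is empty or
  everything, hence itself invariant.\<close>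

section \<open>Binary vectors, their characters and their enumeration by \<open>g\<close>\<close>

definition binary_vecs :: "nat \<Rightarrow> int vec set" where
  "binary_vecs p = {v \<in> carrier_vec p. \<forall>k<p. v $ k \<in> {0, 1}}"

text \<open>For fixed \<open>w\<close> this is a character of the group of binary vectors under
  addition mod 2. The inner product is taken over the integers; on binary vectors it is nonnegative,
  so \<open>nat\<close> truncates nothing there.\<close>

definition walsh :: "int vec \<Rightarrow> int vec \<Rightarrow> int" where
  "walsh v w = (- 1) ^ nat (v \<bullet> w)"

definition Phi_vecs :: "nat \<Rightarrow> int vec set \<Rightarrow> int" where
  "Phi_vecs p S = (\<Prod>w\<in>binary_vecs p - {0\<^sub>v p}. \<Sum>v\<in>S. walsh v w)"

lemma binary_vecsD:
  assumes "v \<in> binary_vecs p"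
  shows "dim_vec v = p" "k < p \<Longrightarrow> v $ k = 0 \<or> v $ k = 1"
  using assms by (auto simp: binary_vecs_def)

lemma binary_vec_in_binary_vecs: "binary_vec p m \<in> binary_vecs p"
  by (auto simp: binary_vecs_def binary_vec_def)

text \<open>The entry at position \<open>p - 1 - k\<close> is bit \<open>k\<close>, so equal vectors
  agree in all bits below \<open>p\<close>; the bits from \<open>p\<close> on vanish because both
  numbers are below \<open>2 ^ p\<close>.\<close>

lemma inj_on_binary_vec: "inj_on (binary_vec p) {..<2 ^ p}"
proof (rule inj_onI)
  fix m n :: nat
  assume m: "m \<in> {..<2 ^ p}" and n: "n \<in> {..<2 ^ p}" and eq: "binary_vec p m = binary_vec p n"
  show "m = n"
  proof (rule bit_eqI)
    fix k :: nat
    show "bit m k \<longleftrightarrow> bit n k"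
    proof (cases "k < p")
      case True
      then have "binary_vec p m $ (p - 1 - k) = binary_vec p n $ (p - 1 - k)" and "p - 1 - k < p"
        and "p - 1 - (p - 1 - k) = k"
        using eq by auto
      then have "int (m div 2 ^ k mod 2) = int (n div 2 ^ k mod 2)"
        unfolding binary_vec_def by simp
      then have "m div 2 ^ k mod 2 = n div 2 ^ k mod 2"
        by (simp only: of_nat_eq_iff)
      then show ?thesis
        by (simp add: bit_iff_odd odd_iff_mod_2_eq_one)
    next
      case False
      then have "(2::nat) ^ p \<le> 2 ^ k"
        by (intro power_increasing) auto
      then have "m div 2 ^ k = 0" "n div 2 ^ k = 0"
        using m n by (simp_all only: lessThan_iff div_less less_le_trans)
      then show ?thesis
        by (simp add: bit_iff_odd)
    qed
  qed
qed

text \<open>A binary vector is determined by its support, a subset of \<open>{..<p}\<close>. The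
  upper bound is enough to make the injective \<open>g\<close> surjective by counting.\<close>

lemma finite_binary_vecs: "finite (binary_vecs p)"
  and card_binary_vecs_le: "card (binary_vecs p) \<le> 2 ^ p"
proof -
  let ?f = "\<lambda>v :: int vec. {k. k < p \<and> v $ k = 1}"
  have inj: "inj_on ?f (binary_vecs p)"
  proof (rule inj_onI)
    fix v w
    assume v: "v \<in> binary_vecs p" and w: "w \<in> binary_vecs p" and eq: "?f v = ?f w"
    show "v = w"
    proof (rule eq_vecI)
      fix k assume "k < dim_vec w"
      then have k: "k < p"
        using w by (simp add: binary_vecsD)
      have "k \<in> ?f v \<longleftrightarrow> k \<in> ?f w"
        by (simp only: eq)
      then show "v $ k = w $ k"
        using k binary_vecsD(2)[OF v k] binary_vecsD(2)[OF w k] by auto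
    qed (use v w in \<open>simp add: binary_vecsD\<close>)
  qed
  have sub: "?f ` binary_vecs p \<subseteq> Pow {..<p}"
    by auto
  show "finite (binary_vecs p)"
    by (rule inj_on_finite[OF inj sub]) simp
  show "card (binary_vecs p) \<le> 2 ^ p"
    using card_inj_on_le[OF inj sub] by (simp add: card_Pow)
qed

lemma bij_betw_g: "bij_betw (g p) {1..2 ^ p} (binary_vecs p)"
proof -
  have inj: "inj_on (g p) {1..2 ^ p}"
  proof (rule inj_onI)
    fix i j :: nat
    assume "i \<in> {1..2 ^ p}" "j \<in> {1..2 ^ p}" "g p i = g p j"
    then have "i - 1 = j - 1"
      by (intro inj_onD[OF inj_on_binary_vec[of p]]) (auto simp: g_def)
    then show "i = j"
      using \<open>i \<in> _\<close> \<open>j \<in> _\<close> by auto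
  qed
  have "g p ` {1..2 ^ p} = binary_vecs p"
  proof (rule card_seteq[OF finite_binary_vecs])
    show "g p ` {1..2 ^ p} \<subseteq> binary_vecs p"
      by (auto simp: g_def binary_vec_in_binary_vecs)
    show "card (binary_vecs p) \<le> card (g p ` {1..2 ^ p})"
      using card_binary_vecs_le[of p] by (simp only: card_image[OF inj]) simp
  qed
  with inj show ?thesis
    by (simp add: bij_betw_def)
qed

lemma g_1: "g p 1 = 0\<^sub>v p"
  by (auto simp: g_def binary_vec_def intro!: eq_vecI)

section \<open>From index sets to sets of rows\<close>

lemma set_rows: "set (rows M) = row M ` {..<dim_row M}"
  by (auto simp: rows_def)

lemma rows_subset_binary_vecs:
  assumes "zero_one_mat r p M"
  shows "set (rows M) \<subseteq> binary_vecs p"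
  using assms by (fastforce simp: zero_one_mat_def set_rows binary_vecs_def elements_mat_def)

text \<open>By definition \<open>alpha p M\<close> is the preimage of the set of rows under
  \<open>g p\<close>. Since every row is binary, hence a value of \<open>g p\<close>, both the inner
  sum and the outer product can be reindexed along \<open>g p\<close>.\<close>

lemma Phi_alpha_eq_Phi_vecs:
  assumes "set (rows M) \<subseteq> binary_vecs p"
  shows "Phi p (alpha p M) = Phi_vecs p (set (rows M))"
proof -
  have inj: "inj_on (g p) {1..2 ^ p}" and img: "g p ` {1..2 ^ p} = binary_vecs p"
    using bij_betw_g[of p] by (auto simp: bij_betw_def)
  have alpha: "bij_betw (g p) (alpha p M) (set (rows M))"
    unfolding bij_betw_def
  proof
    show "inj_on (g p) (alpha p M)"
      by (rule inj_on_subset[OF inj]) (auto simp: alpha_def)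
    show "g p ` alpha p M = set (rows M)"
      using assms unfolding img[symmetric] by (auto simp: alpha_def)
  qed
  have "bij_betw (g p) ({1..2 ^ p} - {1}) (binary_vecs p - {g p 1})"
    by (rule bij_betw_DiffI[OF bij_betw_g]) (auto simp: g_def binary_vec_in_binary_vecs)
  moreover have "{1..2 ^ p} - {1} = {2..2 ^ p :: nat}"
    by auto
  ultimately have bij: "bij_betw (g p) {2..2 ^ p} (binary_vecs p - {0\<^sub>v p})"
    by (simp only: g_1)
  have "Phi p (alpha p M) = (\<Prod>j = 2..2 ^ p. \<Sum>i\<in>alpha p M. walsh (g p i) (g p j))"
    unfolding Phi_def
  proof (intro prod.cong sum.cong refl)
    fix i j :: nat assume "j \<in> {2..2 ^ p}" "i \<in> alpha p M"
    \<comment> \<open>Both indices are at least 1, so the truncated subtraction is undone by the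
      \<open>+ 1\<close> in \<open>sylvester_mat\<close>.\<close>
    then have "i - 1 < 2 ^ p" "j - 1 < 2 ^ p" "i - 1 + 1 = i" "j - 1 + 1 = j"
      by (auto simp: alpha_def)
    then show "sylvester_mat p $$ (i - 1, j - 1) = walsh (g p i) (g p j)"
      unfolding sylvester_mat_def walsh_def by simp
  qed
  also have "\<dots> = (\<Prod>j = 2..2 ^ p. \<Sum>v\<in>set (rows M). walsh v (g p j))"
    by (intro prod.cong refl sum.reindex_bij_betw[OF alpha, where g = "\<lambda>v. walsh v _"])
  also have "\<dots> = Phi_vecs p (set (rows M))"
    unfolding Phi_vecs_def
    by (rule prod.reindex_bij_betw[OF bij, where g = "\<lambda>w. \<Sum>v\<in>set (rows M). walsh v w"])
  finally show ?thesis .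
qed

section \<open>Permutations of rows and columns\<close>

lemma set_rows_permute_rows:
  assumes "\<pi> permutes {..<dim_row M}"
  shows "set (rows (permute_rows \<pi> M)) = set (rows M)"
proof -
  have "row (permute_rows \<pi> M) i = row M (\<pi> i)" if "i < dim_row M" for i
    using that permutes_in_image[OF assms, of i]
    by (intro eq_vecI) (auto simp: permute_rows_def)
  then have "set (rows (permute_rows \<pi> M)) = row M ` (\<pi> ` {..<dim_row M})"
    unfolding set_rows image_image by (intro image_cong) (auto simp: permute_rows_def)
  then show ?thesis
    by (simp add: permutes_image[OF assms] set_rows)
qed

text \<open>The effect of \<open>permute_cols\<close> on a single row.\<close>

definition permute_vec :: "(nat \<Rightarrow> nat) \<Rightarrow> 'a vec \<Rightarrow> 'a vec" where
  "permute_vec \<sigma> v = vec (dim_vec v) (\<lambda>k. v $ \<sigma> k)"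

lemma set_rows_permute_cols:
  assumes "\<sigma> permutes {..<dim_col M}"
  shows "set (rows (permute_cols \<sigma> M)) = permute_vec \<sigma> ` set (rows M)"
proof -
  have "row (permute_cols \<sigma> M) i = permute_vec \<sigma> (row M i)" if "i < dim_row M" for i
    using that permutes_in_image[OF assms]
    by (intro eq_vecI) (auto simp: permute_cols_def permute_vec_def)
  then show ?thesis
    unfolding set_rows image_image by (intro image_cong) (auto simp: permute_cols_def)
qed

lemma permute_vec_inverse:
  assumes "\<sigma> permutes {..<dim_vec v}"
  shows "permute_vec (inv_into UNIV \<sigma>) (permute_vec \<sigma> v) = v"
  using permutes_in_image[OF permutes_inv[OF assms]] permutes_inverses[OF assms]
  by (intro eq_vecI) (auto simp: permute_vec_def)

lemma permute_vec_in_binary_vecs: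
  assumes "\<sigma> permutes {..<p}" "v \<in> binary_vecs p"
  shows "permute_vec \<sigma> v \<in> binary_vecs p"
proof -
  have "permute_vec \<sigma> v $ k \<in> {0, 1}" if "k < p" for k
  proof -
    have "\<sigma> k < p"
      using that permutes_in_image[OF assms(1), of k] by simp
    from binary_vecsD(2)[OF assms(2) this] show ?thesis
      using that binary_vecsD(1)[OF assms(2)] by (simp add: permute_vec_def)
  qed
  moreover have "permute_vec \<sigma> v \<in> carrier_vec p"
    using assms(2) by (simp add: permute_vec_def binary_vecs_def)
  ultimately show ?thesis
    unfolding binary_vecs_def by blast
qed

lemma bij_betw_permute_vec:
  assumes "\<sigma> permutes {..<p}"
  shows "bij_betw (permute_vec \<sigma>) (binary_vecs p) (binary_vecs p)"
proof (rule bij_betw_byWitness[where f' = "permute_vec (inv_into UNIV \<sigma>)"])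
  have inv: "inv_into UNIV \<sigma> permutes {..<p}"
    by (rule permutes_inv[OF assms])
  show "\<forall>v\<in>binary_vecs p. permute_vec (inv_into UNIV \<sigma>) (permute_vec \<sigma> v) = v"
    using permute_vec_inverse[of \<sigma>] assms by (auto dest: binary_vecsD(1))
  show "\<forall>v\<in>binary_vecs p. permute_vec \<sigma> (permute_vec (inv_into UNIV \<sigma>) v) = v"
    using permute_vec_inverse[of "inv_into UNIV \<sigma>"] inv
    by (auto dest: binary_vecsD(1) simp: permutes_inv_inv[OF assms])
  show "permute_vec \<sigma> ` binary_vecs p \<subseteq> binary_vecs p"
    "permute_vec (inv_into UNIV \<sigma>) ` binary_vecs p \<subseteq> binary_vecs p"
    using assms inv by (auto simp: permute_vec_in_binary_vecs)
qed

text \<open>Permuting both arguments alike only reorders the terms of the sum. This is what allows a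
  permutation of \<open>v\<close> to be absorbed by one of \<open>w\<close>.\<close>

lemma scalar_prod_permute_vec:
  assumes "\<sigma> permutes {..<p}" "dim_vec v = p" "dim_vec w = p"
  shows "permute_vec \<sigma> v \<bullet> permute_vec \<sigma> w = v \<bullet> w"
proof -
  have "permute_vec \<sigma> v \<bullet> permute_vec \<sigma> w = (\<Sum>k<p. v $ \<sigma> k * w $ \<sigma> k)"
    using assms by (simp add: scalar_prod_def permute_vec_def atLeast0LessThan)
  also have "\<dots> = (\<Sum>k<p. v $ k * w $ k)"
    by (rule sum.reindex_bij_betw[OF permutes_imp_bij[OF assms(1)], where g = "\<lambda>k. v $ k * w $ k"])
  finally show ?thesis
    using assms by (simp add: scalar_prod_def atLeast0LessThan)
qed

lemma Phi_vecs_permute_vec: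
  assumes \<sigma>: "\<sigma> permutes {..<p}" and S: "S \<subseteq> binary_vecs p"
  shows "Phi_vecs p (permute_vec \<sigma> ` S) = Phi_vecs p S"
proof -
  \<comment> \<open>The zero vector is fixed, so the permutation also acts bijectively on the
    non-zero binary vectors, the range of the product.\<close>
  have zero: "permute_vec \<sigma> (0\<^sub>v p) = (0\<^sub>v p :: int vec)"
    using permutes_in_image[OF \<sigma>] by (intro eq_vecI) (auto simp: permute_vec_def)
  have "bij_betw (permute_vec \<sigma>) (binary_vecs p - {0\<^sub>v p})
      (binary_vecs p - {permute_vec \<sigma> (0\<^sub>v p)})"
    by (rule bij_betw_DiffI[OF bij_betw_permute_vec[OF \<sigma>]]) (auto simp: binary_vecs_def zero)
  then have bij: "bij_betw (permute_vec \<sigma>) (binary_vecs p - {0\<^sub>v p}) (binary_vecs p - {0\<^sub>v p})"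
    by (simp only: zero)
  have inj: "inj_on (permute_vec \<sigma>) S"
    using bij_betw_permute_vec[OF \<sigma>] S by (auto simp: bij_betw_def intro: inj_on_subset)
  have "Phi_vecs p (permute_vec \<sigma> ` S) =
      (\<Prod>w\<in>binary_vecs p - {0\<^sub>v p}. \<Sum>v\<in>S. walsh (permute_vec \<sigma> v) w)"
    by (simp add: Phi_vecs_def sum.reindex[OF inj])
  also have "\<dots> = (\<Prod>w\<in>binary_vecs p - {0\<^sub>v p}.
      \<Sum>v\<in>S. walsh (permute_vec \<sigma> v) (permute_vec \<sigma> w))"
    by (rule prod.reindex_bij_betw[OF bij, symmetric,
          where g = "\<lambda>w. \<Sum>v\<in>S. walsh (permute_vec \<sigma> v) w"])
  also have "\<dots> = Phi_vecs p S"
    unfolding Phi_vecs_def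
  proof (intro prod.cong sum.cong refl)
    fix v w assume "w \<in> binary_vecs p - {0\<^sub>v p}" "v \<in> S"
    then show "walsh (permute_vec \<sigma> v) (permute_vec \<sigma> w) = walsh v w"
      using S by (auto simp: walsh_def scalar_prod_permute_vec[OF \<sigma>] binary_vecsD)
  qed
  finally show ?thesis .
qed

section \<open>Complementation of a column\<close>

definition complement_coord :: "nat \<Rightarrow> int vec \<Rightarrow> int vec" where
  "complement_coord c v = vec (dim_vec v) (\<lambda>k. if k = c then 1 - v $ k else v $ k)"

lemma set_rows_complement_col:
  "set (rows (complement_col c M)) = complement_coord c ` set (rows M)"
proof -
  have "row (complement_col c M) i = complement_coord c (row M i)" if "i < dim_row M" for i
    using that by (intro eq_vecI) (auto simp: complement_col_def complement_coord_def)
  then show ?thesis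
    unfolding set_rows image_image by (intro image_cong) (auto simp: complement_col_def)
qed

lemma complement_coord_complement_coord: "complement_coord c (complement_coord c v) = v"
  by (intro eq_vecI) (auto simp: complement_coord_def)

lemma complement_coord_in_binary_vecs:
  "v \<in> binary_vecs p \<Longrightarrow> complement_coord c v \<in> binary_vecs p"
  by (fastforce simp: binary_vecs_def complement_coord_def)

text \<open>Only the term at \<open>c\<close> changes, and replacing \<open>v $ c\<close> by
  \<open>1 - v $ c\<close> adds \<open>1 - 2 * v $ c\<close> to that entry.\<close>

lemma scalar_prod_complement_coord:
  assumes "c < dim_vec w" "dim_vec v = dim_vec w"
  shows "complement_coord c v \<bullet> w = v \<bullet> w + (1 - 2 * v $ c) * w $ c"
proof -
  have "complement_coord c v \<bullet> w =
      (\<Sum>k = 0..<dim_vec w. v $ k * w $ k + (if k = c then (1 - 2 * v $ k) * w $ k else 0))"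
    unfolding scalar_prod_def using assms
    by (intro sum.cong) (auto simp: complement_coord_def algebra_simps)
  then show ?thesis
    using assms by (simp add: sum.distrib scalar_prod_def)
qed

lemma scalar_prod_binary_vecs_nonneg:
  assumes "v \<in> binary_vecs p" "w \<in> binary_vecs p"
  shows "0 \<le> v \<bullet> w"
  unfolding scalar_prod_def
proof (rule sum_nonneg)
  fix k assume "k \<in> {0..<dim_vec w}"
  then show "0 \<le> v $ k * w $ k"
    using binary_vecsD[OF assms(1)] binary_vecsD[OF assms(2)] by fastforce
qed

text \<open>Reduces signs to parities. Nonnegativity matters, as \<open>nat\<close> sends every
  negative number, odd or even, to 0.\<close>

lemma minus_one_power_nat_eq_if:
  assumes "0 \<le> a"
  shows "(- 1 :: int) ^ nat a = (if even a then 1 else - 1)"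
  using assms by (simp add: even_nat_iff minus_one_power_iff)

text \<open>The inner product changes by an odd multiple of \<open>w $ c\<close>, so its parity
  flips exactly when \<open>w $ c = 1\<close>.\<close>

lemma walsh_complement_coord:
  assumes v: "v \<in> binary_vecs p" and w: "w \<in> binary_vecs p" and c: "c < p"
  shows "walsh (complement_coord c v) w = (- 1) ^ nat (w $ c) * walsh v w"
proof -
  have "complement_coord c v \<bullet> w = v \<bullet> w + (1 - 2 * v $ c) * w $ c"
    using v w c by (simp add: scalar_prod_complement_coord binary_vecsD)
  moreover have "w $ c = 0 \<or> w $ c = 1"
    by (rule binary_vecsD(2)[OF w c])
  ultimately show ?thesis
    unfolding walsh_def minus_one_power_nat_eq_if[OF scalar_prod_binary_vecs_nonneg[OF v w]]
      minus_one_power_nat_eq_if[OF scalar_prod_binary_vecs_nonneg[OF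
          complement_coord_in_binary_vecs[OF v] w]]
    by auto
qed

lemma prod_minus_one_power_coord:
  assumes "c < p" "2 \<le> p"
  shows "(\<Prod>w\<in>binary_vecs p - {0\<^sub>v p}. (- 1 :: int) ^ nat (w $ c)) = 1"
proof -
  \<comment> \<open>A second coordinate exists because \<open>2 \<le> p\<close>.\<close>
  obtain d where d: "d < p" "d \<noteq> c"
  proof (cases "c = 0")
    case True
    then show ?thesis using assms that[of 1] by auto
  next
    case False
    then show ?thesis using assms that[of 0] by auto
  qed
  let ?s = "\<lambda>w :: int vec. (- 1 :: int) ^ nat (w $ c)"
  let ?A = "{w \<in> binary_vecs p. w $ d = 0}" and ?B = "{w \<in> binary_vecs p. w $ d = 1}"
  have bij: "bij_betw (complement_coord d) ?A ?B"
    using d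
    by (intro bij_betw_byWitness[where f' = "complement_coord d"])
      (auto simp: complement_coord_complement_coord complement_coord_in_binary_vecs,
       auto simp: complement_coord_def binary_vecsD)
  \<comment> \<open>Flipping coordinate \<open>d\<close> leaves the entry at \<open>c\<close> alone,
    so paired vectors carry equal signs and each pair contributes a square.\<close>
  have "prod ?s ?B = (\<Prod>w\<in>?A. ?s (complement_coord d w))"
    by (rule prod.reindex_bij_betw[OF bij, symmetric])
  also have "\<dots> = prod ?s ?A"
    using d assms by (intro prod.cong) (auto simp: complement_coord_def binary_vecsD)
  finally have AB: "prod ?s ?B = prod ?s ?A" .
  have "binary_vecs p = ?A \<union> ?B"
    using binary_vecsD(2)[OF _ d(1)] by auto
  then have "prod ?s (binary_vecs p) = prod ?s (?A \<union> ?B)"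
    by simp
  also have "\<dots> = prod ?s ?A * prod ?s ?B"
    by (rule prod.union_disjoint) (auto simp: finite_binary_vecs)
  also have "\<dots> = (\<Prod>w\<in>?A. ?s w * ?s w)"
    by (simp only: AB prod.distrib)
  also have "\<dots> = 1"
    by (intro prod.neutral) (simp flip: power_mult_distrib)
  finally have "prod ?s (binary_vecs p) = 1" .
  \<comment> \<open>The zero vector has sign 1, so leaving it out does not change the
    product.\<close>
  moreover have "prod ?s (binary_vecs p) = ?s (0\<^sub>v p) * prod ?s (binary_vecs p - {0\<^sub>v p})"
    by (rule prod.remove[OF finite_binary_vecs]) (auto simp: binary_vecs_def)
  ultimately show ?thesis
    using assms by simp
qed

lemma Phi_vecs_complement_coord:
  assumes c: "c < p" and p: "2 \<le> p" and S: "S \<subseteq> binary_vecs p"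
  shows "Phi_vecs p (complement_coord c ` S) = Phi_vecs p S"
proof -
  have inj: "inj_on (complement_coord c) S"
    by (rule inj_on_inverseI[of _ "complement_coord c"]) (rule complement_coord_complement_coord)
  have "Phi_vecs p (complement_coord c ` S) =
      (\<Prod>w\<in>binary_vecs p - {0\<^sub>v p}. (- 1) ^ nat (w $ c) * (\<Sum>v\<in>S. walsh v w))"
    unfolding Phi_vecs_def sum.reindex[OF inj] sum_distrib_left
    using S c by (intro prod.cong sum.cong) (auto simp: walsh_complement_coord)
  also have "\<dots> = Phi_vecs p S"
    by (simp add: prod.distrib prod_minus_one_power_coord[OF c p] Phi_vecs_def)
  finally show ?thesis .
qed

lemma complement_coord_image_binary_vecs:
  "complement_coord c ` binary_vecs p = binary_vecs p"
  by (rule bij_betw_imp_surj_on, rule bij_betw_byWitness[where f' = "complement_coord c"])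
    (auto simp: complement_coord_complement_coord complement_coord_in_binary_vecs)

lemma complement_coord_image_length_1:
  assumes S: "S \<subseteq> binary_vecs 1" and "card S \<noteq> 1"
  shows "complement_coord c ` S = S"
proof (cases "S = {}")
  case False
  have fin: "finite S"
    using S finite_binary_vecs finite_subset by blast
  then have "card S \<noteq> 0"
    using False by simp
  \<comment> \<open>There are at most two binary vectors of length 1, and \<open>S\<close> has
    neither 0 nor 1 elements.\<close>
  then have "card (binary_vecs 1) \<le> card S"
    using card_binary_vecs_le[of 1] assms(2) by simp
  then have "S = binary_vecs 1"
    by (rule card_seteq[OF finite_binary_vecs S])
  then show ?thesis
    by (simp add: complement_coord_image_binary_vecs)
qed simp

section \<open>SIOR matrices and the three invariances\<close>

lemma SIOR_imp_distinct_rows: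
  assumes "SIOR r p M"
  shows "distinct (rows M)"
proof -
  have r: "dim_row M = r"
    and less: "\<And>i j. i < j \<Longrightarrow> j < r \<Longrightarrow> binary_value (row M i) < binary_value (row M j)"
    using assms by (auto simp: SIOR_def zero_one_mat_def)
  have "row M i \<noteq> row M j" if "i < r" "j < r" "i \<noteq> j" for i j
    using less[of i j] less[of j i] that by (cases i j rule: linorder_cases) auto
  then show ?thesis
    by (auto simp: distinct_conv_nth r)
qed

theorem theorem1:
  fixes p r :: nat and M :: "int mat"
  assumes "p \<ge> 1"
    and "zero_one_mat r p M"
  shows "(distinct (rows M) \<longrightarrow>
            (\<forall>\<pi>. \<pi> permutes {..<r} \<longrightarrow>
               Phi p (alpha p (permute_rows \<pi> M)) = Phi p (alpha p M)) \<and>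
            (\<forall>\<sigma>. \<sigma> permutes {..<p} \<longrightarrow>
               Phi p (alpha p (permute_cols \<sigma> M)) = Phi p (alpha p M)) \<and>
            (\<not> (p = 1 \<and> r = 1) \<longrightarrow>
               (\<forall>c<p. Phi p (alpha p (complement_col c M)) = Phi p (alpha p M)))) \<and>
         (SIOR r p M \<longrightarrow> distinct (rows M))"
proof (intro conjI impI allI)
  have dim: "dim_row M = r" "dim_col M = p"
    using assms(2) by (auto simp: zero_one_mat_def)
  note sub = rows_subset_binary_vecs[OF assms(2)]
  show "Phi p (alpha p (permute_rows \<pi> M)) = Phi p (alpha p M)" if "\<pi> permutes {..<r}" for \<pi>
    \<comment> \<open>\<open>alpha\<close> depends on the matrix only through its set of
      rows.\<close>
    using that by (simp add: alpha_def set_rows_permute_rows dim)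
  show "Phi p (alpha p (permute_cols \<sigma> M)) = Phi p (alpha p M)" if \<sigma>: "\<sigma> permutes {..<p}" for \<sigma>
  proof -
    have rows: "set (rows (permute_cols \<sigma> M)) = permute_vec \<sigma> ` set (rows M)"
      using \<sigma> by (simp add: set_rows_permute_cols dim)
    then have "set (rows (permute_cols \<sigma> M)) \<subseteq> binary_vecs p"
      using sub permute_vec_in_binary_vecs[OF \<sigma>] by auto
    then show ?thesis
      by (simp add: Phi_alpha_eq_Phi_vecs sub rows Phi_vecs_permute_vec[OF \<sigma> sub])
  qed
  show "Phi p (alpha p (complement_col c M)) = Phi p (alpha p M)"
    if dist: "distinct (rows M)" and pr: "\<not> (p = 1 \<and> r = 1)" and c: "c < p" for c
  proof -
    have "set (rows (complement_col c M)) \<subseteq> binary_vecs p"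
      using sub complement_coord_in_binary_vecs by (auto simp: set_rows_complement_col)
    then have eq: "Phi p (alpha p (complement_col c M)) =
        Phi_vecs p (complement_coord c ` set (rows M))"
      by (simp add: Phi_alpha_eq_Phi_vecs set_rows_complement_col)
    show ?thesis
    proof (cases "p = 1")
      case True
      \<comment> \<open>Distinctness makes \<open>r\<close> the size of the set of rows, so
        \<open>r \<noteq> 1\<close> rules out a singleton.\<close>
      have "card (set (rows M)) = r"
        using distinct_card[OF dist] by (simp add: dim)
      then have "complement_coord c ` set (rows M) = set (rows M)"
        using complement_coord_image_length_1 sub pr True by simp
      then show ?thesis
        by (simp add: eq Phi_alpha_eq_Phi_vecs sub)
    next
      case False
      then have "2 \<le> p"
        using assms(1) by simp
      then show ?thesis
        by (simp add: eq Phi_alpha_eq_Phi_vecs sub Phi_vecs_complement_coord[OF c])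
    qed
  qed
qed (rule SIOR_imp_distinct_rows)

end
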